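(* Let $k\ge 2$ be an integer. Then the maximum of $\|M^{-1}\|$ over all $4\times4$ unimodular matrices $M$ with $\|M\|=k$ and all entries in $\{0,1,\dots,k\}$ equals $$k(2k^2-2k+1),$$ and the maximum of $\|M^{-1}\|$ over all $4\times4$ unimodular matrices $M$ with $\|M\|=k$ and all entries in $\{-k,\dots,-1,0,1,\dots,k\}$ equals $$k(2k-1)(2k+1).$$
   Context: An $n\times n$ integer matrix is called unimodular if its determinant is $\pm1$. For a matrix $X$, $\|X\|$ denotes the maximum absolute value of its entries. *)

theory Defs
  imports "HOL-Analysis.Analysis"
begin

definition unimodular :: "int^'n^'n \<Rightarrow> bool" where
  "unimodular M \<longleftrightarrow> det M = 1 \<or> det M = -1"

definition max_norm :: "int^'n^'n \<Rightarrow> int" where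
  "max_norm M = Max {\<bar>M $ i $ j\<bar> |i j. True}"

end

theory Submission
  imports Defs
begin

text \<open>
  For a unimodular \<open>M\<close> the entries of \<open>M\<^sup>-\<^sup>1\<close> are, up to sign, the cofactors of
  \<open>M\<close>, so the question is how large a \<open>3\<times>3\<close> minor of a unimodular \<open>4\<times>4\<close> matrix can be. Without
  unimodularity the answers would be \<open>2k\<^sup>3\<close> for entries in \<open>{0..k}\<close> and \<open>4k\<^sup>3\<close> for entries in
  \<open>{-k..k}\<close>; these are attained only by minors with too many entries \<open>0\<close> or \<open>\<plusminus>k\<close>
  for a unimodular matrix: if two rows of \<open>M\<close> are divisible by \<open>k\<close> away from one column, then
  modulo \<open>k\<close> these rows are multiples of one unit vector and \<open>k\<close> divides \<open>det M\<close> (\<open>dvd_det_two_rows\<close>).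
  Hence of the three rows of any \<open>3\<times>3\<close> minor at least two, \<open>u\<close> and \<open>v\<close>, contain an entry not divisible
  by \<open>k\<close>, that is, an entry strictly inside the permitted range and different from \<open>0\<close>.

  Writing the minor as \<open>w \<bullet> (u \<times> v)\<close> with the remaining row \<open>w\<close>, the bound reduces to a bound for the
  cross product. If the entries of \<open>w\<close> range over \<open>{0..k}\<close>, the minor is at most \<open>k\<close> times the sum of the
  positive components of \<open>u \<times> v\<close>, and this sum is at most \<open>k\<^sup>2 + (k-1)\<^sup>2\<close>
  (\<open>dot_cross_nonneg_le\<close>). If they range over \<open>{-k..k}\<close>, the minor is at most \<open>k\<close> times the
  sum of the absolute values of the components. After sign changes of the columns this sum is twice
  the area of the triangle with vertices \<open>(u\<^sub>i, v\<^sub>i)\<close> in a square of side \<open>2k\<close>. Twice the area is at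
  most \<open>4k\<^sup>2\<close>, with equality only if the triangle has a side of the square as one of its sides and
  its third vertex on the opposite side; then all \<open>u\<^sub>i\<close> or all \<open>v\<^sub>i\<close> are \<open>\<plusminus>k\<close>, which is excluded. By
  integrality the bound is \<open>4k\<^sup>2 - 1\<close> (\<open>cross_abs_sum_le\<close>). Both bounds are attained by explicit
  matrices.
\<close>

section \<open>Cofactors over a commutative ring\<close>

text \<open>
  Replacing the row by a unit vector, instead of deleting a row and a column, keeps the dimension and
  carries the sign of the cofactor along.
\<close>

definition cofactor :: "'a::comm_ring_1^'n^'n \<Rightarrow> 'n \<Rightarrow> 'n \<Rightarrow> 'a" where
  "cofactor A i j = det (\<chi> a. if a = i then axis j 1 else A $ a)"

lemma row_expansion:
  fixes A :: "'a::comm_ring_1^'n^'n"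
  shows "det (\<chi> a. if a = i then x else A $ a) = (\<Sum>j\<in>UNIV. x $ j * cofactor A i j)"
proof -
  have "det (\<chi> a. if a = i then x else A $ a)
      = det (\<chi> a. if a = i then (\<Sum>j\<in>UNIV. x $ j *s axis j 1) else A $ a)"
    by (simp only: basis_expansion)
  also have "\<dots> = (\<Sum>j\<in>UNIV. det (\<chi> a. if a = i then x $ j *s axis j 1 else A $ a))"
    by (rule det_linear_row_sum) simp
  also have "\<dots> = (\<Sum>j\<in>UNIV. x $ j * cofactor A i j)"
    by (simp add: det_row_mul cofactor_def)
  finally show ?thesis .
qed

corollary det_row_expansion:
  fixes A :: "'a::comm_ring_1^'n^'n"
  shows "det A = (\<Sum>j\<in>UNIV. A $ i $ j * cofactor A i j)"
proof -
  have "(\<chi> a. if a = i then A $ i else A $ a) = A"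
    by (simp add: vec_eq_iff)
  with row_expansion[of i "A $ i" A] show ?thesis by simp
qed

lemma alien_row_expansion:
  fixes A :: "'a::comm_ring_1^'n^'n"
  assumes "i \<noteq> i'"
  shows "(\<Sum>j\<in>UNIV. A $ i' $ j * cofactor A i j) = 0"
proof -
  have "det (\<chi> a. if a = i then A $ i' else A $ a) = 0"
    by (rule det_identical_rows[OF assms]) (use assms in \<open>simp add: row_def\<close>)
  then show ?thesis by (simp add: row_expansion)
qed

text \<open>
  The scalar \<open>d\<close> is kept free because the inverse of a unimodular matrix is the adjugate scaled by
  \<open>d = det A\<close>, where \<open>d * det A = 1\<close>.
\<close>

lemma matrix_mul_adjugate:
  fixes A :: "'a::comm_ring_1^'n^'n"
  shows "A ** (\<chi> j i. d * cofactor A i j) = mat (d * det A)"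
proof -
  have "(\<Sum>j\<in>UNIV. A $ a $ j * (d * cofactor A i j)) = (if a = i then d * det A else 0)" for a i
  proof -
    have "(\<Sum>j\<in>UNIV. A $ a $ j * (d * cofactor A i j)) = d * (\<Sum>j\<in>UNIV. A $ a $ j * cofactor A i j)"
      by (simp add: sum_distrib_left mult.left_commute)
    then show ?thesis
      using det_row_expansion[of A i] alien_row_expansion[of i a A] by auto
  qed
  then show ?thesis
    by (simp add: matrix_matrix_mult_def mat_def vec_eq_iff)
qed

text \<open>
  The row expansion gives only a right inverse, and over the integers a one-sided inverse is not yet
  an inverse. Applied to the transpose, the same construction yields a left inverse, and the two
  must agree.
\<close>

lemma matrix_inv_cofactor:
  fixes M :: "int^'n^'n"
  assumes "unimodular M"
  shows "matrix_inv M $ j $ i = det M * cofactor M i j"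
proof -
  have sq: "det M * det M = 1"
    using assms by (auto simp: unimodular_def)
  define N where "N = (\<chi> j i. det M * cofactor M i j)"
  define P where "P = (\<chi> j i. det M * cofactor (transpose M) i j)"
  have MN: "M ** N = mat 1"
    using matrix_mul_adjugate[of M "det M"] sq by (simp add: N_def)
  have "transpose M ** P = mat 1"
    using matrix_mul_adjugate[of "transpose M" "det M"] sq by (simp add: P_def)
  then have PM: "transpose P ** M = mat 1"
    by (metis matrix_transpose_mul transpose_mat transpose_transpose)
  have uniq: "Q = N" if "Q ** M = mat 1" for Q
    by (metis MN matrix_mul_assoc matrix_mul_lid matrix_mul_rid that)
  have "N ** M = mat 1"
    using PM uniq by metis
  with MN have "\<exists>Q. M ** Q = mat 1 \<and> Q ** M = mat 1" by blast
  then have "matrix_inv M ** M = mat 1"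
    unfolding matrix_inv_def by (rule someI2_ex) simp
  then have "matrix_inv M = N" by (rule uniq)
  then show ?thesis by (simp add: N_def)
qed

text \<open>
  Modulo \<open>d\<close> both rows are multiples of the same unit vector. Expanding along row \<open>a\<close> leaves modulo \<open>d\<close>
  only the cofactor at \<open>j\<close>; expanding that along row \<open>b\<close> leaves a determinant with two equal rows.
\<close>

lemma dvd_det_two_rows:
  fixes A :: "'a::comm_ring_1^'n^'n"
  assumes ab: "a \<noteq> b"
    and a: "\<And>q. q \<noteq> j \<Longrightarrow> d dvd A $ a $ q" and b: "\<And>q. q \<noteq> j \<Longrightarrow> d dvd A $ b $ q"
  shows "d dvd det A"
proof -
  define B where "B = (\<chi> r. if r = a then axis j 1 else A $ r)"
  have "cofactor B b j = 0"
    unfolding cofactor_def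
    by (rule det_identical_rows[OF ab]) (use ab in \<open>simp add: row_def B_def\<close>)
  then have "d dvd B $ b $ q * cofactor B b q" for q
    using b[of q] ab by (cases "q = j") (auto simp: B_def)
  then have "d dvd det B"
    unfolding det_row_expansion[of B b] by (intro dvd_sum)
  then have "d dvd cofactor A a j" by (simp add: B_def cofactor_def)
  then have "d dvd A $ a $ q * cofactor A a q" for q
    using a[of q] by (cases "q = j") auto
  then show ?thesis
    unfolding det_row_expansion[of A a] by (intro dvd_sum)
qed

section \<open>Minors of order three in dimension four\<close>

lemma det_4:
  fixes A :: "'a::comm_ring_1^4^4"
  shows "det A =
    A$1$1 * (A$2$2 * (A$3$3 * A$4$4 - A$3$4 * A$4$3) - A$2$3 * (A$3$2 * A$4$4 - A$3$4 * A$4$2)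
             + A$2$4 * (A$3$2 * A$4$3 - A$3$3 * A$4$2))
  - A$1$2 * (A$2$1 * (A$3$3 * A$4$4 - A$3$4 * A$4$3) - A$2$3 * (A$3$1 * A$4$4 - A$3$4 * A$4$1)
             + A$2$4 * (A$3$1 * A$4$3 - A$3$3 * A$4$1))
  + A$1$3 * (A$2$1 * (A$3$2 * A$4$4 - A$3$4 * A$4$2) - A$2$2 * (A$3$1 * A$4$4 - A$3$4 * A$4$1)
             + A$2$4 * (A$3$1 * A$4$2 - A$3$2 * A$4$1))
  - A$1$4 * (A$2$1 * (A$3$2 * A$4$3 - A$3$3 * A$4$2) - A$2$2 * (A$3$1 * A$4$3 - A$3$3 * A$4$1)
             + A$2$3 * (A$3$1 * A$4$2 - A$3$2 * A$4$1))"
proof -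
  have f: "finite {2::4, 3, 4}" "1 \<notin> {2::4, 3, 4}" "finite {3::4, 4}" "2 \<notin> {3::4, 4}"
    "finite {4::4}" "3 \<notin> {4::4}"
    by auto
  show ?thesis
    unfolding det_def UNIV_4
    unfolding sum_over_permutations_insert[OF f(1,2)]
    unfolding sum_over_permutations_insert[OF f(3,4)]
    unfolding sum_over_permutations_insert[OF f(5,6)]
    unfolding permutes_sing
    by (simp add: sign_swap_id permutation_swap_id permutation_compose sign_compose sign_id swap_id_eq
        algebra_simps)
qed

text \<open>
  The determinant of the submatrix with rows \<open>a, b, c\<close> and columns \<open>p, q, r\<close>, in the form of the triple
  product of row \<open>a\<close> with the cross product of rows \<open>b\<close> and \<open>c\<close>.
\<close>

definition minor3 :: "'a::comm_ring_1^'n^'n \<Rightarrow> 'n \<Rightarrow> 'n \<Rightarrow> 'n \<Rightarrow> 'n \<Rightarrow> 'n \<Rightarrow> 'n \<Rightarrow> 'a" where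
  "minor3 A a b c p q r =
     A$a$p * (A$b$q * A$c$r - A$b$r * A$c$q)
   + A$a$q * (A$b$r * A$c$p - A$b$p * A$c$r)
   + A$a$r * (A$b$p * A$c$q - A$b$q * A$c$p)"

lemma cofactor_4:
  fixes A :: "'a::comm_ring_1^4^4"
  shows
    "cofactor A 1 1 = minor3 A 2 3 4 2 3 4" "cofactor A 1 2 = - minor3 A 2 3 4 1 3 4"
    "cofactor A 1 3 = minor3 A 2 3 4 1 2 4" "cofactor A 1 4 = - minor3 A 2 3 4 1 2 3"
    "cofactor A 2 1 = - minor3 A 1 3 4 2 3 4" "cofactor A 2 2 = minor3 A 1 3 4 1 3 4"
    "cofactor A 2 3 = - minor3 A 1 3 4 1 2 4" "cofactor A 2 4 = minor3 A 1 3 4 1 2 3"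
    "cofactor A 3 1 = minor3 A 1 2 4 2 3 4" "cofactor A 3 2 = - minor3 A 1 2 4 1 3 4"
    "cofactor A 3 3 = minor3 A 1 2 4 1 2 4" "cofactor A 3 4 = - minor3 A 1 2 4 1 2 3"
    "cofactor A 4 1 = - minor3 A 1 2 3 2 3 4" "cofactor A 4 2 = minor3 A 1 2 3 1 3 4"
    "cofactor A 4 3 = - minor3 A 1 2 3 1 2 4" "cofactor A 4 4 = minor3 A 1 2 3 1 2 3"
  by (simp_all add: cofactor_def det_4 axis_def minor3_def algebra_simps)

lemma abs_cofactor_minor3:
  fixes A :: "int^4^4"
  obtains a b c p q r where "distinct [i, a, b, c]" "distinct [j, p, q, r]"
    "\<bar>cofactor A i j\<bar> = \<bar>minor3 A a b c p q r\<bar>"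
proof -
  define F :: "(4 \<times> 4 \<times> 4 \<times> 4) set"
    where "F = {(1, 2, 3, 4), (2, 1, 3, 4), (3, 1, 2, 4), (4, 1, 2, 3)}"
  have F: "\<exists>a b c. (i, a, b, c) \<in> F" for i
    using exhaust_4[of i] by (auto simp: F_def)
  obtain a b c p q r where abc: "(i, a, b, c) \<in> F" and pqr: "(j, p, q, r) \<in> F"
    using F[of i] F[of j] by blast
  show thesis
    by (rule that[of a b c p q r]) (use abc pqr in \<open>auto simp: F_def cofactor_4\<close>)
qed

text \<open>
  Here unimodularity enters: at least two of the three rows of the minor have an entry not divisible
  by \<open>k\<close>. As \<open>minor3\<close> is invariant under cyclic shifts of the rows, these may be taken to be the
  second and the third.
\<close>

lemma abs_cofactor_le:
  fixes M :: "int^4^4"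
  assumes M: "unimodular M" and k: "k \<ge> 2"
    and bound: "\<And>a b c p q r. \<lbrakk>\<exists>s\<in>{p, q, r}. \<not> k dvd M $ b $ s; \<exists>s\<in>{p, q, r}. \<not> k dvd M $ c $ s\<rbrakk>
      \<Longrightarrow> \<bar>minor3 M a b c p q r\<bar> \<le> B"
  shows "\<bar>cofactor M i j\<bar> \<le> B"
proof -
  obtain a b c p q r where abc: "distinct [i, a, b, c]" and pqr: "distinct [j, p, q, r]"
    and eq: "\<bar>cofactor M i j\<bar> = \<bar>minor3 M a b c p q r\<bar>"
    by (rule abs_cofactor_minor3)
  define good where "good x \<longleftrightarrow> (\<exists>s\<in>{p, q, r}. \<not> k dvd M $ x $ s)" for x
  have cols: "s \<in> {p, q, r}" if "s \<noteq> j" for s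
    using pqr that exhaust_4[of s] exhaust_4[of j] exhaust_4[of p] exhaust_4[of q] exhaust_4[of r]
    by auto
  have "\<not> k dvd det M"
    using M k by (auto simp: unimodular_def zdvd1_eq)
  then have two: "good x \<or> good y" if "x \<noteq> y" for x y
    using dvd_det_two_rows[OF that, of j k M] cols by (auto simp: good_def)
  have cyc: "minor3 M a b c p q r = minor3 M b c a p q r" "minor3 M a b c p q r = minor3 M c a b p q r"
    by (simp_all add: minor3_def algebra_simps)
  have "a \<noteq> b" "b \<noteq> c" "a \<noteq> c" using abc by auto
  with two consider "good b" "good c" | "good c" "good a" | "good a" "good b"
    by metis
  then have "\<bar>minor3 M a b c p q r\<bar> \<le> B"
  proof cases
    case 1 then show ?thesis by (intro bound) (auto simp: good_def)
  next
    case 2 then show ?thesis unfolding cyc(1) by (intro bound) (auto simp: good_def)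
  next
    case 3 then show ?thesis unfolding cyc(2) by (intro bound) (auto simp: good_def)
  qed
  with eq show ?thesis by simp
qed

text \<open>
  The only multiples of \<open>k\<close> in the two entry ranges are \<open>0\<close> and \<open>\<plusminus>k\<close>.
\<close>

lemma not_dvd_interior:
  fixes k x :: int
  assumes "\<not> k dvd x"
  shows "0 \<le> x \<Longrightarrow> x \<le> k \<Longrightarrow> x \<in> {1..k - 1}"
    and "\<bar>x\<bar> \<le> k \<Longrightarrow> \<bar>x\<bar> \<le> k - 1"
proof -
  have "x \<noteq> 0" "x \<noteq> k" "x \<noteq> -k" using assms by auto
  then show "0 \<le> x \<Longrightarrow> x \<le> k \<Longrightarrow> x \<in> {1..k - 1}" "\<bar>x\<bar> \<le> k \<Longrightarrow> \<bar>x\<bar> \<le> k - 1" by auto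
qed

section \<open>Entries between 0 and k\<close>

text \<open>
  The left-hand side is the sum of the first two components of \<open>u \<times> v\<close>. Each of its two products is
  at most \<open>k * k\<close>, and the interior entry of \<open>u\<close> lowers one factor to \<open>k - 1\<close>, as does that of \<open>v\<close>. If
  both lowered factors are in the same product, the bound is \<open>k\<^sup>2 + (k-1)\<^sup>2\<close>; otherwise it is the
  smaller \<open>2k(k-1)\<close>.
\<close>

lemma sum_two_cross_components_le:
  fixes k :: int
  assumes k: "k \<ge> 2"
    and u: "{u1, u2, u3} \<subseteq> {0..k}" and v: "{v1, v2, v3} \<subseteq> {0..k}"
    and u': "\<exists>x\<in>{u1, u2, u3}. x \<in> {1..k-1}" and v': "\<exists>x\<in>{v1, v2, v3}. x \<in> {1..k-1}"
  shows "v3 * (u2 - u1) + u3 * (v1 - v2) \<le> 2 * k\<^sup>2 - 2 * k + 1"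
proof -
  have prod: "x * y \<le> m * n" if "0 \<le> x" "x \<le> m" "y \<le> n" "0 \<le> n" for x y m n :: int
    using mult_mono[of x m "max y 0" n] mult_left_mono[of y "max y 0" x] that by auto
  have bs: "(k - 1) * k + k * (k - 1) \<le> 2 * k\<^sup>2 - 2 * k + 1"
    "k * k + (k - 1) * (k - 1) = 2 * k\<^sup>2 - 2 * k + 1"
    by (simp_all add: power2_eq_square algebra_simps)
  consider "u3 \<le> k - 1" "v3 \<le> k - 1" | "u3 \<le> k - 1" "v1 - v2 \<le> k - 1"
    | "u2 - u1 \<le> k - 1" "v3 \<le> k - 1" | "u2 - u1 \<le> k - 1" "v1 - v2 \<le> k - 1"
    using u v u' v' by auto
  then show ?thesis
  proof cases
    case 1
    then show ?thesis using prod[of v3 "k-1" "u2 - u1" k] prod[of u3 "k-1" "v1 - v2" k] u v k bs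
      by (auto simp: algebra_simps)
  next
    case 2
    then show ?thesis using prod[of v3 k "u2 - u1" k] prod[of u3 "k-1" "v1 - v2" "k-1"] u v k bs
      by (auto simp: algebra_simps)
  next
    case 3
    then show ?thesis using prod[of v3 "k-1" "u2 - u1" "k-1"] prod[of u3 k "v1 - v2" k] u v k bs
      by (auto simp: algebra_simps)
  next
    case 4
    then show ?thesis using prod[of v3 k "u2 - u1" "k-1"] prod[of u3 k "v1 - v2" "k-1"] u v k bs
      by (auto simp: algebra_simps)
  qed
qed

text \<open>
  The left-hand side is the sum of all three components of \<open>u \<times> v\<close>. The positive parts of the three
  cyclic differences sum to the range of the \<open>v\<^sub>i\<close>, which is at most \<open>k\<close>.
\<close>

lemma weighted_differences_le:
  fixes k :: int
  assumes "{u1, u2, u3} \<subseteq> {0..k}" and v: "{v1, v2, v3} \<subseteq> {0..k}"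
  shows "u1 * (v2 - v3) + u2 * (v3 - v1) + u3 * (v1 - v2) \<le> k\<^sup>2"
proof -
  have pos: "x * y \<le> k * max y 0" if "x \<in> {0..k}" for x y
    using that mult_mono[of x k "max y 0" "max y 0"] mult_left_mono[of y "max y 0" x] by auto
  have "u1 * (v2 - v3) + u2 * (v3 - v1) + u3 * (v1 - v2)
     \<le> k * (max (v2 - v3) 0 + max (v3 - v1) 0 + max (v1 - v2) 0)"
    using pos[of u1 "v2 - v3"] pos[of u2 "v3 - v1"] pos[of u3 "v1 - v2"] assms(1)
    by (simp add: distrib_left)
  also have "\<dots> \<le> k * k"
    by (rule mult_left_mono) (use assms in auto)
  finally show ?thesis by (simp add: power2_eq_square)
qed

text \<open>
  The sum of the positive components of \<open>u \<times> v\<close> is the sum over some subset of the components. Two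
  components are the critical case; one or all three contribute at most \<open>k\<^sup>2\<close>.
\<close>

lemma dot_cross_nonneg_le:
  fixes k :: int
  assumes k: "k \<ge> 2" and w: "{w1, w2, w3} \<subseteq> {0..k}"
    and u: "{u1, u2, u3} \<subseteq> {0..k}" and v: "{v1, v2, v3} \<subseteq> {0..k}"
    and u': "\<exists>x\<in>{u1, u2, u3}. x \<in> {1..k-1}" and v': "\<exists>x\<in>{v1, v2, v3}. x \<in> {1..k-1}"
  shows "w1 * (u2 * v3 - u3 * v2) + w2 * (u3 * v1 - u1 * v3) + w3 * (u1 * v2 - u2 * v1)
    \<le> k * (2 * k\<^sup>2 - 2 * k + 1)"
proof -
  define P Q R where "P = u2 * v3 - u3 * v2" and "Q = u3 * v1 - u1 * v3" and "R = u1 * v2 - u2 * v1"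
  note defs = P_def Q_def R_def
  let ?B = "2 * k\<^sup>2 - 2 * k + 1"
  have sq: "k\<^sup>2 \<le> ?B" "0 \<le> ?B"
    using zero_le_power2[of "k - 1"] by (simp_all add: power2_diff) (use zero_le_power2[of k] in linarith)
  have "v3 * (u2 - u1) + u3 * (v1 - v2) \<le> ?B" "v1 * (u3 - u2) + u1 * (v2 - v3) \<le> ?B"
    "v2 * (u1 - u3) + u2 * (v3 - v1) \<le> ?B"
    by (rule sum_two_cross_components_le[OF k]; use u v u' v' in blast)+
  then have two: "P + Q \<le> ?B" "Q + R \<le> ?B" "R + P \<le> ?B"
    by (simp_all add: defs algebra_simps)
  have single: "x * y - z * t \<le> ?B" if "{x, y, z, t} \<subseteq> {0..k}" for x y z t
  proof -
    have "0 \<le> z * t" "x * y \<le> k * k" using that by (auto intro!: mult_mono)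
    with sq show ?thesis by (simp add: power2_eq_square)
  qed
  have one: "P \<le> ?B" "Q \<le> ?B" "R \<le> ?B"
    using single[of u2 v3 u3 v2] single[of u3 v1 u1 v3] single[of u1 v2 u2 v1] u v by (auto simp: defs)
  have three: "P + Q + R \<le> ?B"
    using weighted_differences_le[OF u v] sq by (simp add: defs algebra_simps)
  have pos: "x * y \<le> k * max y 0" if "x \<in> {0..k}" for x y
    using that mult_mono[of x k "max y 0" "max y 0"] mult_left_mono[of y "max y 0" x] by auto
  have "w1 * P + w2 * Q + w3 * R \<le> k * (max P 0 + max Q 0 + max R 0)"
    using pos[of w1 P] pos[of w2 Q] pos[of w3 R] w by (simp add: distrib_left)
  also have "\<dots> \<le> k * ?B"
  proof (rule mult_left_mono)
    show "max P 0 + max Q 0 + max R 0 \<le> ?B"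
      using one two three sq by (simp add: max_def)
  qed (use k in simp)
  finally show ?thesis by (simp add: defs)
qed

lemma minor3_nonneg_le:
  fixes M :: "int^'n^'n"
  assumes k: "k \<ge> 2" and M: "\<And>i j. M $ i $ j \<in> {0..k}"
    and b: "\<exists>s\<in>{p, q, r}. \<not> k dvd M $ b $ s" and c: "\<exists>s\<in>{p, q, r}. \<not> k dvd M $ c $ s"
  shows "\<bar>minor3 M a b c p q r\<bar> \<le> k * (2 * k\<^sup>2 - 2 * k + 1)"
proof -
  have rows: "{M $ x $ p, M $ x $ q, M $ x $ r} \<subseteq> {0..k}" for x using M by auto
  have interior: "\<exists>y\<in>{M $ x $ p, M $ x $ q, M $ x $ r}. y \<in> {1..k-1}"
    if "\<exists>s\<in>{p, q, r}. \<not> k dvd M $ x $ s" for x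
    using that not_dvd_interior(1) M by auto
  have "minor3 M a b c p q r \<le> k * (2 * k\<^sup>2 - 2 * k + 1)"
    using dot_cross_nonneg_le[OF k rows rows rows interior[OF b] interior[OF c], of a]
    by (simp add: minor3_def)
  moreover have "- minor3 M a b c p q r \<le> k * (2 * k\<^sup>2 - 2 * k + 1)"
    using dot_cross_nonneg_le[OF k rows rows rows interior[OF c] interior[OF b], of a]
    by (simp add: minor3_def algebra_simps)
  ultimately show ?thesis by linarith
qed

section \<open>Entries between -k and k\<close>

text \<open>
  The left-hand side is twice the signed area of the triangle with vertices \<open>(u\<^sub>i, v\<^sub>i)\<close>. The absolute
  cyclic differences of the \<open>v\<^sub>i\<close> sum to twice their range, hence to at most \<open>4k\<close>, and the bound
  \<open>\<bar>u1\<bar> \<le> k - 1\<close> gains \<open>\<bar>v2 - v3\<bar>\<close> over \<open>4k\<^sup>2\<close>. The gain vanishes only if \<open>v2 = v3\<close>; then the \<open>v\<^sub>i\<close>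
  take at most two values, one of which is interior, and the range is at most \<open>2k - 1\<close>.
\<close>

lemma triangle_area_le:
  fixes k :: int
  assumes u: "\<bar>u1\<bar> \<le> k - 1" "\<bar>u2\<bar> \<le> k" "\<bar>u3\<bar> \<le> k"
    and v: "\<bar>v1\<bar> \<le> k" "\<bar>v2\<bar> \<le> k" "\<bar>v3\<bar> \<le> k"
    and v': "\<exists>x\<in>{v1, v2, v3}. \<bar>x\<bar> \<le> k - 1"
  shows "u1 * (v2 - v3) + u2 * (v3 - v1) + u3 * (v1 - v2) \<le> 4 * k\<^sup>2 - 1"
proof -
  have k: "k \<ge> 1" using u by linarith
  have prod: "x * y \<le> m * \<bar>y\<bar>" if "\<bar>x\<bar> \<le> m" for x y m :: int
    using abs_ge_self[of "x * y"] mult_right_mono[OF that, of "\<bar>y\<bar>"] by (simp add: abs_mult)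
  let ?S = "\<bar>v2 - v3\<bar> + \<bar>v3 - v1\<bar> + \<bar>v1 - v2\<bar>"
  have le: "u1 * (v2 - v3) + u2 * (v3 - v1) + u3 * (v1 - v2) \<le> k * ?S - \<bar>v2 - v3\<bar>"
    using prod[OF u(1), of "v2 - v3"] prod[OF u(2), of "v3 - v1"] prod[OF u(3), of "v1 - v2"]
    by (simp add: algebra_simps)
  show ?thesis
  proof (cases "v2 = v3")
    case True
    have "k * ?S \<le> k * (4 * k - 2)"
      by (rule mult_left_mono) (use True v v' k in auto)
    with le True k show ?thesis by (simp add: power2_eq_square algebra_simps)
  next
    case False
    have "k * ?S \<le> k * (4 * k)"
      by (rule mult_left_mono) (use v k in auto)
    with le False show ?thesis by (simp add: power2_eq_square algebra_simps)
  qed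
qed

lemma abs_triangle_area_le:
  fixes k :: int
  assumes u: "\<bar>u1\<bar> \<le> k" "\<bar>u2\<bar> \<le> k" "\<bar>u3\<bar> \<le> k" and u': "\<exists>x\<in>{u1, u2, u3}. \<bar>x\<bar> \<le> k - 1"
    and v: "\<bar>v1\<bar> \<le> k" "\<bar>v2\<bar> \<le> k" "\<bar>v3\<bar> \<le> k" and v': "\<exists>x\<in>{v1, v2, v3}. \<bar>x\<bar> \<le> k - 1"
  shows "\<bar>u1 * (v2 - v3) + u2 * (v3 - v1) + u3 * (v1 - v2)\<bar> \<le> 4 * k\<^sup>2 - 1"
proof -
  have upper: "u1 * (v2 - v3) + u2 * (v3 - v1) + u3 * (v1 - v2) \<le> 4 * k\<^sup>2 - 1"
    if "\<bar>u1\<bar> \<le> k" "\<bar>u2\<bar> \<le> k" "\<bar>u3\<bar> \<le> k" "\<exists>x\<in>{u1, u2, u3}. \<bar>x\<bar> \<le> k - 1" for u1 u2 u3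
  proof -
    from that(4) consider "\<bar>u1\<bar> \<le> k - 1" | "\<bar>u2\<bar> \<le> k - 1" | "\<bar>u3\<bar> \<le> k - 1" by auto
    then show ?thesis
    proof cases
      case 1 with triangle_area_le[of u1 k u2 u3 v1 v2 v3] that v v' show ?thesis by simp
    next
      case 2 with triangle_area_le[of u2 k u3 u1 v2 v3 v1] that v v' show ?thesis by auto
    next
      case 3 with triangle_area_le[of u3 k u1 u2 v3 v1 v2] that v v' show ?thesis by auto
    qed
  qed
  have "- (u1 * (v2 - v3) + u2 * (v3 - v1) + u3 * (v1 - v2)) \<le> 4 * k\<^sup>2 - 1"
    using upper[of "-u1" "-u2" "-u3"] u u' by (simp add: algebra_simps)
  with upper[OF u u'] show ?thesis by linarith
qed

text \<open>
  Changing the signs of columns preserves the hypotheses and turns the area form \<open>P + Q + R\<close>, where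
  \<open>P\<close>, \<open>Q\<close>, \<open>R\<close> are the components of \<open>u \<times> v\<close>, into every signed sum \<open>\<plusminus>P \<plusminus> Q \<plusminus> R\<close> with positive product
  of signs. The absolute value supplies the remaining sign patterns.
\<close>

lemma cross_abs_sum_le:
  fixes k :: int
  assumes u: "\<bar>u1\<bar> \<le> k" "\<bar>u2\<bar> \<le> k" "\<bar>u3\<bar> \<le> k" and u': "\<exists>x\<in>{u1, u2, u3}. \<bar>x\<bar> \<le> k - 1"
    and v: "\<bar>v1\<bar> \<le> k" "\<bar>v2\<bar> \<le> k" "\<bar>v3\<bar> \<le> k" and v': "\<exists>x\<in>{v1, v2, v3}. \<bar>x\<bar> \<le> k - 1"
  shows "\<bar>u2 * v3 - u3 * v2\<bar> + \<bar>u3 * v1 - u1 * v3\<bar> + \<bar>u1 * v2 - u2 * v1\<bar> \<le> 4 * k\<^sup>2 - 1"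
proof -
  define P Q R where "P = u2 * v3 - u3 * v2" and "Q = u3 * v1 - u1 * v3" and "R = u1 * v2 - u2 * v1"
  have signed: "\<bar>t * P + s * Q + s * t * R\<bar> \<le> 4 * k\<^sup>2 - 1"
    if "\<bar>s\<bar> = 1" "\<bar>t\<bar> = 1" for s t
  proof -
    have "\<bar>s * u1 * (t * v2 - v3) + t * u2 * (v3 - s * v1) + u3 * (s * v1 - t * v2)\<bar> \<le> 4 * k\<^sup>2 - 1"
      by (rule abs_triangle_area_le) (use assms in \<open>simp_all add: abs_mult that\<close>)
    moreover have "s * u1 * (t * v2 - v3) + t * u2 * (v3 - s * v1) + u3 * (s * v1 - t * v2)
       = t * P + s * Q + s * t * R"
      by (simp add: P_def Q_def R_def algebra_simps)
    ultimately show ?thesis by simp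
  qed
  have "\<bar>P\<bar> + \<bar>Q\<bar> + \<bar>R\<bar> \<le> 4 * k\<^sup>2 - 1"
    using signed[of 1 1] signed[of 1 "-1"] signed[of "-1" 1] signed[of "-1" "-1"]
    unfolding abs_le_iff by simp linarith
  then show ?thesis by (simp only: P_def Q_def R_def)
qed

lemma minor3_symmetric_le:
  fixes M :: "int^'n^'n"
  assumes k: "k \<ge> 2" and M: "\<And>i j. M $ i $ j \<in> {-k..k}"
    and b: "\<exists>s\<in>{p, q, r}. \<not> k dvd M $ b $ s" and c: "\<exists>s\<in>{p, q, r}. \<not> k dvd M $ c $ s"
  shows "\<bar>minor3 M a b c p q r\<bar> \<le> k * (2 * k - 1) * (2 * k + 1)"
proof -
  have M': "\<bar>M $ i $ j\<bar> \<le> k" for i j using M[of i j] by auto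
  have interior: "\<exists>y\<in>{M $ x $ p, M $ x $ q, M $ x $ r}. \<bar>y\<bar> \<le> k - 1"
    if "\<exists>s\<in>{p, q, r}. \<not> k dvd M $ x $ s" for x
    using that not_dvd_interior(2) M' by auto
  define P Q R where "P = M$b$q * M$c$r - M$b$r * M$c$q" and "Q = M$b$r * M$c$p - M$b$p * M$c$r"
    and "R = M$b$p * M$c$q - M$b$q * M$c$p"
  have "\<bar>M $ a $ x * y\<bar> \<le> k * \<bar>y\<bar>" for x y
    unfolding abs_mult by (rule mult_right_mono[OF M']) simp
  from this[of p P] this[of q Q] this[of r R]
  have "\<bar>minor3 M a b c p q r\<bar> \<le> k * (\<bar>P\<bar> + \<bar>Q\<bar> + \<bar>R\<bar>)"
    unfolding minor3_def P_def[symmetric] Q_def[symmetric] R_def[symmetric] distrib_left by linarith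
  also have "\<dots> \<le> k * (4 * k\<^sup>2 - 1)"
  proof (rule mult_left_mono)
    show "\<bar>P\<bar> + \<bar>Q\<bar> + \<bar>R\<bar> \<le> 4 * k\<^sup>2 - 1"
      unfolding P_def Q_def R_def by (rule cross_abs_sum_le[OF M' M' M' interior[OF b] M' M' M' interior[OF c]])
  qed (use k in simp)
  also have "\<dots> = k * (2 * k - 1) * (2 * k + 1)"
    by (simp add: power2_eq_square algebra_simps)
  finally show ?thesis .
qed

lemma abs_cofactor_nonneg_le:
  fixes M :: "int^4^4"
  assumes "k \<ge> 2" "unimodular M" "\<forall>i j. M $ i $ j \<in> {0..k}"
  shows "\<bar>cofactor M i j\<bar> \<le> k * (2 * k\<^sup>2 - 2 * k + 1)"
  using assms by (intro abs_cofactor_le[where k = k] minor3_nonneg_le) auto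


lemma abs_cofactor_symmetric_le:
  fixes M :: "int^4^4"
  assumes "k \<ge> 2" "unimodular M" "\<forall>i j. M $ i $ j \<in> {-k..k}"
  shows "\<bar>cofactor M i j\<bar> \<le> k * (2 * k - 1) * (2 * k + 1)"
  using assms by (intro abs_cofactor_le[where k = k] minor3_symmetric_le) auto


section \<open>The maximum norm of the inverse\<close>

lemma max_norm_le_iff:
  fixes M :: "int^'n^'n"
  shows "max_norm M \<le> B \<longleftrightarrow> (\<forall>i j. \<bar>M $ i $ j\<bar> \<le> B)"
proof -
  have "{\<bar>M $ i $ j\<bar> |i j. True} = (\<lambda>(i, j). \<bar>M $ i $ j\<bar>) ` UNIV" by auto
  then have "finite {\<bar>M $ i $ j\<bar> |i j. True}" "{\<bar>M $ i $ j\<bar> |i j. True} \<noteq> {}" by auto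
  then show ?thesis unfolding max_norm_def by (subst Max_le_iff) auto
qed

lemma abs_le_max_norm:
  fixes M :: "int^'n^'n"
  shows "\<bar>M $ i $ j\<bar> \<le> max_norm M"
  using max_norm_le_iff by blast

lemma max_norm_eqI:
  fixes M :: "int^'n^'n"
  assumes "\<And>i j. \<bar>M $ i $ j\<bar> \<le> B" and "\<bar>M $ i $ j\<bar> = B"
  shows "max_norm M = B"
  using assms abs_le_max_norm[of M i j] by (simp add: order_antisym max_norm_le_iff)

text \<open>
  The set of norms must be shown finite, since \<open>Max\<close> has no specified value on infinite sets; the bound \<open>B\<close>
  provides this too.
\<close>

lemma Max_max_norm_inverse:
  fixes P :: "int^'n^'n \<Rightarrow> bool"
  assumes uni: "\<And>M. P M \<Longrightarrow> unimodular M"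
    and bound: "\<And>M i j. P M \<Longrightarrow> \<bar>cofactor M i j\<bar> \<le> B"
    and W: "P W" "\<bar>cofactor W i j\<bar> = B"
  shows "Max {max_norm (matrix_inv M) |M. P M} = B"
proof (rule Max_eqI)
  have inv: "\<bar>matrix_inv M $ s $ r\<bar> = \<bar>cofactor M r s\<bar>" if "P M" for M r s
    using matrix_inv_cofactor[OF uni[OF that]] uni[OF that]
    by (auto simp: unimodular_def)
  have le: "max_norm (matrix_inv M) \<le> B" if "P M" for M
    using bound[OF that] by (simp add: max_norm_le_iff inv[OF that])
  have "0 \<le> max_norm M" for M :: "int^'n^'n"
    using abs_le_max_norm[of M undefined undefined] by linarith
  with le have "{max_norm (matrix_inv M) |M. P M} \<subseteq> {0..B}" by auto
  then show "finite {max_norm (matrix_inv M) |M. P M}"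
    by (rule finite_subset) simp
  show "y \<le> B" if "y \<in> {max_norm (matrix_inv M) |M. P M}" for y
    using that le by auto
  have "max_norm (matrix_inv W) = B"
    by (rule max_norm_eqI[of _ _ j i]) (use bound W in \<open>simp_all add: inv\<close>)
  with W(1) show "B \<in> {max_norm (matrix_inv M) |M. P M}" by blast
qed

section \<open>Extremal matrices\<close>

lemma vector_4:
  "(vector [x, y, z, w] :: 'a::zero^4) $ 1 = x" "(vector [x, y, z, w] :: 'a::zero^4) $ 2 = y"
  "(vector [x, y, z, w] :: 'a::zero^4) $ 3 = z" "(vector [x, y, z, w] :: 'a::zero^4) $ 4 = w"
  by (simp_all add: vector_def)

theorem mainTheorem2:
  fixes k :: int
  assumes "k \<ge> 2"
  shows "Max {max_norm (matrix_inv M) |M :: int^4^4.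
            unimodular M \<and> max_norm M = k \<and> (\<forall>i j. M $ i $ j \<in> {0..k})}
          = k * (2 * k\<^sup>2 - 2 * k + 1)
       \<and> Max {max_norm (matrix_inv M) |M :: int^4^4.
            unimodular M \<and> max_norm M = k \<and> (\<forall>i j. M $ i $ j \<in> {-k..k})}
          = k * (2 * k - 1) * (2 * k + 1)"
proof
  \<comment> \<open>The leading minor meets every estimate with equality: its rows 2 and 3 have one interior entry
    each, placed so that both lowered factors are in the same product. The border makes the
    determinant \<open>\<plusminus>1\<close>.\<close>
  define W :: "int^4^4" where "W = vector [vector [k, k, 0, 1], vector [0, k - 1, k, 1],
    vector [k, 0, k - 1, 0], vector [1, 0, 1, 0]]"
  have "unimodular W"
    by (simp add: unimodular_def W_def det_4 vector_4 algebra_simps)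
  moreover have "\<forall>i j. W $ i $ j \<in> {0..k}"
    using assms by (simp add: forall_4 W_def vector_4)
  moreover have "max_norm W = k"
  proof (rule max_norm_eqI[of W k 1 1])
    show "\<bar>W $ i $ j\<bar> \<le> k" for i j
      using \<open>\<forall>i j. W $ i $ j \<in> {0..k}\<close> by simp
  qed (use assms in \<open>simp add: W_def vector_4\<close>)
  moreover have "\<bar>cofactor W 4 4\<bar> = k * (2 * k\<^sup>2 - 2 * k + 1)"
  proof -
    have "cofactor W 4 4 = k * (2 * k\<^sup>2 - 2 * k + 1)"
      by (simp add: cofactor_def det_4 W_def vector_4 axis_def power2_eq_square algebra_simps)
    moreover have "0 \<le> k * (2 * k\<^sup>2 - 2 * k + 1)"
      using assms mult_mono[of 1 k 1 "2 * k\<^sup>2 - 2 * k + 1"] by (simp add: power2_eq_square)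
    ultimately show ?thesis by simp
  qed
  ultimately show "Max {max_norm (matrix_inv M) |M :: int^4^4.
            unimodular M \<and> max_norm M = k \<and> (\<forall>i j. M $ i $ j \<in> {0..k})}
          = k * (2 * k\<^sup>2 - 2 * k + 1)"
    by (intro Max_max_norm_inverse[where W = W and i = 4 and j = 4])
       (use abs_cofactor_nonneg_le[OF assms] in simp_all)
next
  \<comment> \<open>The matrix with diagonal \<open>-k\<close> and \<open>k\<close> elsewhere has determinant \<open>4k\<^sup>3\<close> and vanishing diagonal
    cofactors; raising two diagonal entries by 1 therefore costs only the second-order term \<open>k\<close>. The
    border again makes the determinant \<open>\<plusminus>1\<close>.\<close>
  define W :: "int^4^4" where "W = vector [vector [1 - k, k, k, 0], vector [k, 1 - k, k, - 1],
    vector [k, k, - k, 1], vector [- 1, 1, 1, 0]]"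
  have "unimodular W"
    by (simp add: unimodular_def W_def det_4 vector_4 algebra_simps)
  moreover have "\<forall>i j. W $ i $ j \<in> {-k..k}"
    using assms by (simp add: forall_4 W_def vector_4)
  moreover have "max_norm W = k"
  proof (rule max_norm_eqI[of W k 1 2])
    show "\<bar>W $ i $ j\<bar> \<le> k" for i j
      using \<open>\<forall>i j. W $ i $ j \<in> {-k..k}\<close> by (simp add: abs_le_iff minus_le_iff)
  qed (use assms in \<open>simp add: W_def vector_4\<close>)
  moreover have "\<bar>cofactor W 4 4\<bar> = k * (2 * k - 1) * (2 * k + 1)"
  proof -
    have "cofactor W 4 4 = k * (2 * k - 1) * (2 * k + 1)"
      by (simp add: cofactor_def det_4 W_def vector_4 axis_def algebra_simps)
    moreover have "0 \<le> k * (2 * k - 1) * (2 * k + 1)"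
      using assms by simp
    ultimately show ?thesis by simp
  qed
  ultimately show "Max {max_norm (matrix_inv M) |M :: int^4^4.
            unimodular M \<and> max_norm M = k \<and> (\<forall>i j. M $ i $ j \<in> {-k..k})}
          = k * (2 * k - 1) * (2 * k + 1)"
    by (intro Max_max_norm_inverse[where W = W and i = 4 and j = 4])
       (use abs_cofactor_symmetric_le[OF assms] in simp_all)
qed

end
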